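(* Let $P_X\in\mathcal P(\mathcal X^n)$ and $P_{\hat S}\in\mathcal P(\mathcal S^k)$ be arbitrary, let $q_\Theta^*\in\Pi_\Theta$ and $q^*(\theta)=\prod_{i=1}^nq_\Theta^*(\theta_i)$. There exists a random joint source-channel code $\psi$ such that $$e_{\mathbf d}(\psi)\le\min_{P_{L|S}}\max_{\theta\in\mathcal T^n}\Big(\mathbb E\big[\exp\big(-|i_{X;Y_{q^*}}(X;Y)-\log L|^+\big)\,\big|\,\theta\big]+\mathbb E\big[(1-P_{\hat S}(\mathcal B_{\mathbf d}(S)))^L\big]\Big),$$ where the minimum is over conditional distributions $P_{L|S}$ of a positive-integer-valued random variable $L$ given $S$, and $(S,L,\hat S,X,Y)\sim P_S\times P_{L|S}\times P_{\hat S}\times P_X\times P_{Y|X,\Theta=\theta}$.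
   Context: Finite sets $\mathcal X,\mathcal Y,\mathcal T,\mathcal S$; channels $P_{\mathbb Y|\mathbb X,\Theta}$ with memoryless extension $P_{Y|X,\Theta}(y|x,\theta)=\prod_{i=1}^nP_{\mathbb Y|\mathbb X,\Theta}(y_i|x_i,\theta_i)$. Source $S\in\mathcal S^k$ i.i.d. with $P_S=P_{\mathbb S}^{\otimes k}$; distortion $d(s,\hat s)=\frac1k\sum_id_{\mathsf S}(s_i,\hat s_i)$, level $\mathbf d$; $\mathcal B_{\mathbf d}(s)=\{\hat s\in\mathcal S^k:d(s,\hat s)\le\mathbf d\}$. A deterministic joint source-channel code is a pair $(f,\varphi)$, $f:\mathcal S^k\to\mathcal X^n$, $\varphi:\mathcal Y^n\to\mathcal S^k$, with $e_{\mathbf d,\theta}(f,\varphi)=\sum_{s,y}\mathbb I\{d(s,\varphi(y))>\mathbf d\}P_S(s)P_{Y|X,\Theta}(y|f(s),\theta)$. A random code is a random pair $(F,\Phi)\sim\psi$ of such codes; $e_{\mathbf d,\theta}(\psi)=\mathbb E[e_{\mathbf d,\theta}(F,\Phi)]$ and $e_{\mathbf d}(\psi)=\max_{\theta\in\mathcal T^n}e_{\mathbf d,\theta}(\psi)$. $C=\max_{P_{\mathbb X}}\min_{q_\Theta}I(\mathbb X;\mathbb Y_{q_\Theta})$ (averaged channel $\sum_\theta q_\Theta(\theta)P_{\mathbb Y|\mathbb X,\Theta=\theta}$), and $\Pi_\Theta=\{q_\Theta\in\mathcal P(\mathcal T):\max_{P_{\mathbb X}}I(\mathbb X;\mathbb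 Y_{q_\Theta})=C\}$. $i_{X;Y_{q^*}}(x;y)=\log\frac{(q^*P_{Y|X,\Theta})(y|x)}{(P_Xq^*P_{Y|X,\Theta})(y)}$ where $(q^*P_{Y|X,\Theta})(y|x)=\sum_\theta q^*(\theta)P_{Y|X,\Theta}(y|x,\theta)$ and $(P_Xq^*P_{Y|X,\Theta})(y)=\sum_xP_X(x)(q^*P_{Y|X,\Theta})(y|x)$. $|a|^+=\max(a,0)$; $\log,\exp$ base 2. *)

theory Defs
  imports "HOL-Probability.Probability"
begin

definition lists_len :: "nat \<Rightarrow> 'a list set" where
  "lists_len n = {xs. length xs = n}"

definition avg_chan :: "('x::finite \<Rightarrow> 't::finite \<Rightarrow> 'y pmf) \<Rightarrow> 't pmf \<Rightarrow> 'x \<Rightarrow> 'y \<Rightarrow> real" where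
  "avg_chan W q x y = (\<Sum>\<theta>\<in>UNIV. pmf q \<theta> * pmf (W x \<theta>) y)"

text \<open>Mutual information (base 2) of input P and channel V (V x y = V(y|x)), with 0 log 0 = 0.\<close>
definition mutual_info :: "'x::finite pmf \<Rightarrow> ('x \<Rightarrow> 'y::finite \<Rightarrow> real) \<Rightarrow> real" where
  "mutual_info P V = (\<Sum>x\<in>UNIV. \<Sum>y\<in>UNIV.
      pmf P x * V x y * log 2 (V x y / (\<Sum>x'\<in>UNIV. pmf P x' * V x' y)))"

definition capacity :: "('x::finite \<Rightarrow> 't::finite \<Rightarrow> 'y::finite pmf) \<Rightarrow> real" where
  "capacity W = (SUP P. INF q. mutual_info P (avg_chan W q))"

definition Pi_Theta :: "('x::finite \<Rightarrow> 't::finite \<Rightarrow> 'y::finite pmf) \<Rightarrow> 't pmf set" where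
  "Pi_Theta W = {q. (SUP P. mutual_info P (avg_chan W q)) = capacity W}"

definition chan_n :: "('x \<Rightarrow> 't \<Rightarrow> 'y pmf) \<Rightarrow> nat \<Rightarrow> 'x list \<Rightarrow> 't list \<Rightarrow> 'y list \<Rightarrow> real" where
  "chan_n W n x \<theta> y = (\<Prod>i<n. pmf (W (x!i) (\<theta>!i)) (y!i))"

definition source_k :: "'s pmf \<Rightarrow> nat \<Rightarrow> 's list \<Rightarrow> real" where
  "source_k PS k s = (\<Prod>i<k. pmf PS (s!i))"

definition distortion :: "('s \<Rightarrow> 's \<Rightarrow> real) \<Rightarrow> nat \<Rightarrow> 's list \<Rightarrow> 's list \<Rightarrow> real" where
  "distortion dS k s sh = (1 / real k) * (\<Sum>i<k. dS (s!i) (sh!i))"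

definition dball :: "('s \<Rightarrow> 's \<Rightarrow> real) \<Rightarrow> nat \<Rightarrow> real \<Rightarrow> 's list \<Rightarrow> 's list set" where
  "dball dS k dl s = {sh \<in> lists_len k. distortion dS k s sh \<le> dl}"

definition code_error ::
  "('x \<Rightarrow> 't \<Rightarrow> 'y pmf) \<Rightarrow> 's pmf \<Rightarrow> ('s \<Rightarrow> 's \<Rightarrow> real) \<Rightarrow> real \<Rightarrow> nat \<Rightarrow> nat
   \<Rightarrow> ('s list \<Rightarrow> 'x list) \<Rightarrow> ('y list \<Rightarrow> 's list) \<Rightarrow> 't list \<Rightarrow> real" where
  "code_error W PS dS dl k n f \<phi> \<theta> =
     (\<Sum>s\<in>lists_len k. \<Sum>y\<in>lists_len n.
        (if distortion dS k s (\<phi> y) > dl then 1 else 0) * source_k PS k s * chan_n W n (f s) \<theta> y)"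

definition is_rcode :: "nat \<Rightarrow> nat \<Rightarrow> (('s list \<Rightarrow> 'x list) \<times> ('y list \<Rightarrow> 's list)) pmf \<Rightarrow> bool" where
  "is_rcode k n \<psi> \<longleftrightarrow> (\<forall>(f, \<phi>) \<in> set_pmf \<psi>.
      (\<forall>s \<in> lists_len k. f s \<in> lists_len n) \<and> (\<forall>y \<in> lists_len n. \<phi> y \<in> lists_len k))"

definition rcode_error ::
  "('x \<Rightarrow> 't \<Rightarrow> 'y pmf) \<Rightarrow> 's pmf \<Rightarrow> ('s \<Rightarrow> 's \<Rightarrow> real) \<Rightarrow> real \<Rightarrow> nat \<Rightarrow> nat
   \<Rightarrow> (('s list \<Rightarrow> 'x list) \<times> ('y list \<Rightarrow> 's list)) pmf \<Rightarrow> real" where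
  "rcode_error W PS dS dl k n \<psi> =
     Max ((\<lambda>\<theta>. measure_pmf.expectation \<psi> (\<lambda>(f, \<phi>). code_error W PS dS dl k n f \<phi> \<theta>)) ` lists_len n)"

definition qchan_n :: "('x \<Rightarrow> 't \<Rightarrow> 'y pmf) \<Rightarrow> 't pmf \<Rightarrow> nat \<Rightarrow> 'x list \<Rightarrow> 'y list \<Rightarrow> real" where
  "qchan_n W qT n x y = (\<Sum>\<theta>\<in>lists_len n. (\<Prod>i<n. pmf qT (\<theta>!i)) * chan_n W n x \<theta> y)"

definition info_dens :: "('x \<Rightarrow> 't \<Rightarrow> 'y pmf) \<Rightarrow> 't pmf \<Rightarrow> nat \<Rightarrow> 'x list pmf \<Rightarrow> 'x list \<Rightarrow> 'y list \<Rightarrow> real" where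
  "info_dens W qT n PX x y =
     log 2 (qchan_n W qT n x y / (\<Sum>x'\<in>lists_len n. pmf PX x' * qchan_n W qT n x' y))"

definition bound_term1 ::
  "('x \<Rightarrow> 't \<Rightarrow> 'y pmf) \<Rightarrow> 't pmf \<Rightarrow> 's pmf \<Rightarrow> nat \<Rightarrow> nat \<Rightarrow> 'x list pmf
   \<Rightarrow> ('s list \<Rightarrow> nat pmf) \<Rightarrow> 't list \<Rightarrow> real" where
  "bound_term1 W qT PS k n PX PL \<theta> =
     (\<Sum>s\<in>lists_len k. source_k PS k s *
        measure_pmf.expectation (PL s) (\<lambda>l.
          \<Sum>x\<in>lists_len n. pmf PX x * (\<Sum>y\<in>lists_len n. chan_n W n x \<theta> y *
             2 powr (- max 0 (info_dens W qT n PX x y - log 2 (real l))))))"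

definition bound_term2 ::
  "'s pmf \<Rightarrow> ('s \<Rightarrow> 's \<Rightarrow> real) \<Rightarrow> real \<Rightarrow> nat \<Rightarrow> 's list pmf \<Rightarrow> ('s list \<Rightarrow> nat pmf) \<Rightarrow> real" where
  "bound_term2 PS dS dl k PSh PL =
     (\<Sum>s\<in>lists_len k. source_k PS k s *
        measure_pmf.expectation (PL s) (\<lambda>l. (1 - measure_pmf.prob PSh (dball dS k dl s)) ^ l))"

end

theory Submission
  imports Defs
begin

text \<open>
  Poisson matching. Attach independent standard exponential clocks \<open>E u\<close> to the pairs \<open>u = (sh, x)\<close> of
  reproduction and channel input; a weight function \<open>w\<close> selects the \<open>u\<close> minimising \<open>E u / w u\<close>.
  Weights \<open>w\<close> and \<open>w'\<close> both select \<open>u\<close> with probability at least \<open>1 / (\<Sum>w / w u + \<Sum>w' / w' u)\<close>.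
  The encoder uses \<open>PSh \<times> PX\<close> restricted to the distortion ball of \<open>s\<close>, of mass \<open>p\<close>; the decoder uses
  \<open>PSh \<times> PX\<close> weighted by the averaged channel. Hence, with \<open>a = 2 powr - i(x; y)\<close>, they disagree with
  probability at most \<open>a / (p + a)\<close>, and Bernoulli's inequality gives
  \<open>a / (p + a) \<le> min 1 (l * a) + (1 - p) ^ l\<close> for every \<open>l\<close>.
  The code does not depend on the law of \<open>L\<close>, so one code serves all choices of \<open>PL\<close>.
\<close>

section \<open>Races between independent exponential clocks\<close>

lemma exponential_tail:
  assumes "a \<ge> 0"
  shows "emeasure (density lborel (exponential_density 1)) {a<..} = ennreal (exp (- a))"
proof -
  let ?M = "density lborel (exponential_density 1)"
  interpret prob_space ?M by (rule prob_space_exponential_density) simp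
  have "distributed ?M lborel (\<lambda>x. x) (exponential_density 1)"
    by (auto simp: distributed_def exponential_density_nonneg intro!: measure_eqI simp: emeasure_distr)
  from exponential_distributedD_gt[OF this assms] show ?thesis
    by (simp add: emeasure_eq_measure greaterThan_def)
qed

text \<open>Tilting the density of rate \<open>1\<close> by \<open>exp (- c * y)\<close> gives the
  density of rate \<open>1 + c\<close> up to the factor \<open>1 / (1 + c)\<close>, and that density
  has total mass one.\<close>

lemma nn_integral_exponential_tilt:
  assumes "c \<ge> 0"
  shows "(\<integral>\<^sup>+ y. ennreal (exp (- c * y)) \<partial>density lborel (exponential_density 1)) = ennreal (1 / (1 + c))"
proof -
  interpret prob_space "density lborel (exponential_density (1 + c))"
    by (rule prob_space_exponential_density) (use assms in simp)
  have "(\<integral>\<^sup>+ y. ennreal (exp (- c * y)) \<partial>density lborel (exponential_density 1))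
      = (\<integral>\<^sup>+ y. ennreal (exponential_density 1 y) * ennreal (exp (- c * y)) \<partial>lborel)"
    by (subst nn_integral_density) auto
  also have "\<dots> = (\<integral>\<^sup>+ y. ennreal (1 / (1 + c)) * ennreal (exponential_density (1 + c) y) \<partial>lborel)"
    using assms
    by (intro nn_integral_cong)
       (auto simp: exponential_density_def ennreal_mult'[symmetric] exp_add[symmetric] field_simps)
  also have "\<dots> = ennreal (1 / (1 + c)) * emeasure (density lborel (exponential_density (1 + c))) UNIV"
    by (subst nn_integral_cmult) (auto simp: emeasure_density)
  also have "\<dots> = ennreal (1 / (1 + c))"
    using emeasure_space_1 by simp
  finally show ?thesis .
qed

text \<open>Given the clock of \<open>u\<close> at \<open>y\<close>, the other clocks outlast their
  thresholds \<open>c v * y\<close> independently, each with probability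
  \<open>exp (- c v * y)\<close>. Averaging the product over \<open>y\<close> is the Laplace
  transform just computed.\<close>

lemma exponential_race:
  fixes U :: "'u set" and c :: "'u \<Rightarrow> real"
  assumes "finite U" "u \<in> U" and c: "\<And>v. v \<in> U - {u} \<Longrightarrow> c v \<ge> 0"
  defines "M \<equiv> PiM U (\<lambda>_. density lborel (exponential_density 1))"
  shows "emeasure M {\<omega> \<in> space M. \<forall>v\<in>U - {u}. c v * \<omega> u < \<omega> v}
       = ennreal (1 / (1 + (\<Sum>v\<in>U - {u}. c v)))"
proof -
  let ?E = "density lborel (exponential_density 1)"
  interpret E: prob_space ?E by (rule prob_space_exponential_density) simp
  interpret product_prob_space "\<lambda>_. ?E" by standard
  let ?V = "U - {u}"
  have U: "U = insert u ?V" and V: "finite ?V" "u \<notin> ?V"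
    using assms by auto
  let ?A = "{\<omega> \<in> space M. \<forall>v\<in>?V. c v * \<omega> u < \<omega> v}"
  have [measurable]: "(\<lambda>\<omega>. \<omega> v) \<in> borel_measurable M" if "v \<in> U" for v
    using measurable_component_singleton[OF that, of "\<lambda>_. ?E"] unfolding M_def by simp
  have A: "?A \<in> sets M"
    using \<open>u \<in> U\<close> V(1) by (intro sets.sets_Collect_finite_All borel_measurable_less) auto
  have M': "M = PiM (insert u ?V) (\<lambda>_. ?E)"
    unfolding M_def using U by simp
  have "emeasure M ?A = (\<integral>\<^sup>+ \<omega>. indicator ?A \<omega> \<partial>M)"
    using A by simp
  \<comment> \<open>Fubini with the clock of \<open>u\<close> outermost, so that the inner event is
    a box in the remaining clocks.\<close>
  also have "\<dots> = (\<integral>\<^sup>+ y. (\<integral>\<^sup>+ x. indicator ?A (x(u := y)) \<partial>(PiM ?V (\<lambda>_. ?E))) \<partial>?E)"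
    unfolding M' by (rule product_nn_integral_insert_rev[OF V]) (use A M' in simp)
  also have "\<dots> = (\<integral>\<^sup>+ y. ennreal (exp (- (\<Sum>v\<in>?V. c v) * y)) \<partial>?E)"
  proof (rule nn_integral_cong_AE)
    have "AE y in ?E. y \<ge> 0"
      by (subst AE_density) (auto simp: exponential_density_def)
    then show "AE y in ?E. (\<integral>\<^sup>+ x. indicator ?A (x(u := y)) \<partial>(PiM ?V (\<lambda>_. ?E)))
                 = ennreal (exp (- (\<Sum>v\<in>?V. c v) * y))"
    proof eventually_elim
      fix y :: real assume y: "y \<ge> 0"
      have "(\<integral>\<^sup>+ x. indicator ?A (x(u := y)) \<partial>(PiM ?V (\<lambda>_. ?E)))
          = (\<integral>\<^sup>+ \<omega>. indicator (PiE ?V (\<lambda>v. {c v * y<..})) \<omega> \<partial>(PiM ?V (\<lambda>_. ?E)))"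
        using \<open>u \<in> U\<close>
        by (intro nn_integral_cong)
           (auto simp: indicator_def M_def space_PiM PiE_iff extensional_def)
      also have "\<dots> = emeasure (PiM ?V (\<lambda>_. ?E)) (PiE ?V (\<lambda>v. {c v * y<..}))"
        using V by (intro nn_integral_indicator sets_PiM_I_finite) auto
      also have "\<dots> = (\<Prod>v\<in>?V. emeasure ?E {c v * y<..})"
        using V by (intro emeasure_PiM) auto
      also have "\<dots> = (\<Prod>v\<in>?V. ennreal (exp (- (c v * y))))"
        using c y by (intro prod.cong refl exponential_tail) auto
      also have "\<dots> = ennreal (exp (- (\<Sum>v\<in>?V. c v) * y))"
        using V by (simp add: prod_ennreal exp_sum[symmetric] sum_distrib_right sum_negf)
      finally show "(\<integral>\<^sup>+ x. indicator ?A (x(u := y)) \<partial>(PiM ?V (\<lambda>_. ?E)))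
                 = ennreal (exp (- (\<Sum>v\<in>?V. c v) * y))" .
    qed
  qed
  also have "\<dots> = ennreal (1 / (1 + (\<Sum>v\<in>?V. c v)))"
    by (intro nn_integral_exponential_tilt sum_nonneg c)
  finally show ?thesis .
qed

section \<open>Coupled selections driven by one vector of clocks\<close>

text \<open>A random code must be a \<open>pmf\<close>, while the clocks live on a continuous space.
  Only the finitely many selections matter, so their law can be transferred.\<close>

lemma finite_range_pmf:
  assumes "prob_space M" and g: "g \<in> measurable M (count_space C)" and "finite C"
  obtains \<kappa> where "set_pmf \<kappa> \<subseteq> C"
    "\<And>A. measure_pmf.prob \<kappa> A = measure M {\<omega> \<in> space M. g \<omega> \<in> A}"
proof
  interpret prob_space M by fact
  have g': "g \<in> measurable M (count_space UNIV)"
    using measurable_compose[OF g, of "\<lambda>x. x" "count_space UNIV"] by simp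
  let ?N = "distr M (count_space UNIV) g"
  interpret N: prob_space ?N by (rule prob_space_distr[OF g'])
  have "AE x in ?N. x \<in> C"
    using measurable_space[OF g] by (subst AE_distr_iff[OF g']) auto
  \<comment> \<open>\<open>Abs_pmf\<close> requires that almost every point be an atom;
    concentration on a finite set ensures this.\<close>
  then have "AE x in ?N. measure ?N {x} \<noteq> 0"
    using \<open>finite C\<close> N.AE_support_countable by (auto intro: countable_finite)
  then have \<kappa>: "measure_pmf (Abs_pmf ?N) = ?N"
    using N.prob_space_axioms by (intro Abs_pmf_inverse) auto
  show pr: "measure_pmf.prob (Abs_pmf ?N) A = measure M {\<omega> \<in> space M. g \<omega> \<in> A}" for A
    unfolding \<kappa> by (subst measure_distr[OF g']) (auto intro!: arg_cong[where f = "measure M"])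
  show "set_pmf (Abs_pmf ?N) \<subseteq> C"
  proof
    fix x assume "x \<in> set_pmf (Abs_pmf ?N)"
    then have "measure M {\<omega> \<in> space M. g \<omega> \<in> {x}} \<noteq> 0"
      unfolding pr[symmetric] by (simp add: measure_pmf_single set_pmf_iff)
    then have "{\<omega> \<in> space M. g \<omega> \<in> {x}} \<noteq> {}"
      by (metis measure_empty)
    then show "x \<in> C"
      using measurable_space[OF g] by auto
  qed
qed

text \<open>All indices read the same clocks, so the event that \<open>i\<close> and
  \<open>j\<close> both select \<open>u\<close> is a single race whose thresholds are the larger of
  the two weight ratios.\<close>

lemma exponential_race_coupling:
  fixes U :: "'u set" and I :: "'i set" and w :: "'i \<Rightarrow> 'u \<Rightarrow> real"
  assumes U: "finite U" "U \<noteq> {}" and I: "finite I"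
    and w: "\<And>i u. i \<in> I \<Longrightarrow> u \<in> U \<Longrightarrow> w i u \<ge> 0"
  obtains \<kappa> where "set_pmf \<kappa> \<subseteq> PiE I (\<lambda>_. U)"
    "\<And>i j u. \<lbrakk>i \<in> I; j \<in> I; u \<in> U; w i u > 0; w j u > 0\<rbrakk> \<Longrightarrow>
       measure_pmf.prob \<kappa> {g. g i = u \<and> g j = u} \<ge> 1 / (sum (w i) U / w i u + sum (w j) U / w j u)"
proof -
  define M where "M = PiM U (\<lambda>_. density lborel (exponential_density 1))"
  have [measurable]: "(\<lambda>\<omega>. \<omega> v) \<in> borel_measurable M" if "v \<in> U" for v
    using measurable_component_singleton[OF that, of "\<lambda>_. density lborel (exponential_density 1)"]
    unfolding M_def by simp
  interpret M: prob_space M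
    unfolding M_def by (intro prob_space_PiM prob_space_exponential_density) simp
  \<comment> \<open>This is the comparison of \<open>\<omega> u / w i u\<close> with
    \<open>\<omega> v / w i v\<close>, multiplied out so that zero weights cause no division.
    Strictness makes the winner unique.\<close>
  define wins where "wins i u \<omega> \<longleftrightarrow> u \<in> U \<and> (\<forall>v\<in>U - {u}. w i v * \<omega> u < w i u * \<omega> v)" for i u \<omega>
  have unique: "u = v" if "wins i u \<omega>" "wins i v \<omega>" for i u v \<omega>
  proof (rule ccontr)
    assume "u \<noteq> v"
    with that have "w i v * \<omega> u < w i u * \<omega> v" "w i u * \<omega> v < w i v * \<omega> u"
      unfolding wins_def by auto
    then show False by simp
  qed
  have [measurable]: "Measurable.pred M (wins i u)" for i u
  proof (cases "u \<in> U")
    case True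
    have "{\<omega> \<in> space M. \<forall>v\<in>U - {u}. w i v * \<omega> u < w i u * \<omega> v} \<in> sets M"
      using U(1) True by (intro sets.sets_Collect_finite_All borel_measurable_less) auto
    then show ?thesis
      unfolding wins_def[abs_def] pred_def using True by simp
  qed (simp add: wins_def[abs_def])
  \<comment> \<open>An arbitrary default for outcomes without a winner, such as a tie for the
    minimum. The lower bound counts only strict wins.\<close>
  obtain u0 where u0: "u0 \<in> U" using U by auto
  define sel where "sel i \<omega> = (if \<exists>u\<in>U. wins i u \<omega> then THE u. wins i u \<omega> else u0)" for i \<omega>
  have sel_eq: "sel i \<omega> = u" if "wins i u \<omega>" for i u \<omega>
    using that unique unfolding sel_def by (auto simp: wins_def intro!: the_equality)
  have sel_in: "sel i \<omega> \<in> U" for i \<omega>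
    using sel_eq u0 by (metis sel_def)
  have [measurable]: "(\<lambda>\<omega>. THE u. wins i u \<omega>) \<in> measurable M (count_space UNIV)" for i
    by (rule measurable_THE[where I = U]) (use U unique in \<open>auto simp: wins_def intro: countable_finite\<close>)
  have [measurable]: "sel i \<in> measurable M (count_space UNIV)" for i
    unfolding sel_def using U by measurable
  define g where "g \<omega> = (\<lambda>i\<in>I. sel i \<omega>)" for \<omega>
  have fin: "finite (PiE I (\<lambda>_. U))"
    using U I by (intro finite_PiE) auto
  have "g \<in> measurable M (count_space (PiE I (\<lambda>_. U)))"
    unfolding measurable_count_space_eq2[OF fin]
  proof (intro conjI ballI)
    show "g \<in> space M \<rightarrow> PiE I (\<lambda>_. U)"
      by (auto simp: g_def sel_in)
    fix a assume a: "a \<in> PiE I (\<lambda>_. U)"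
    have "g -` {a} \<inter> space M = {\<omega> \<in> space M. \<forall>i\<in>I. sel i \<omega> = a i}"
      using a by (auto simp: g_def fun_eq_iff PiE_iff extensional_def)
    also have "\<dots> \<in> sets M"
      using I by measurable
    finally show "g -` {a} \<inter> space M \<in> sets M" .
  qed
  then obtain \<kappa> where \<kappa>: "set_pmf \<kappa> \<subseteq> PiE I (\<lambda>_. U)"
      "\<And>A. measure_pmf.prob \<kappa> A = measure M {\<omega> \<in> space M. g \<omega> \<in> A}"
    using finite_range_pmf[OF M.prob_space_axioms _ fin] by blast
  show thesis
  proof (rule that[OF \<kappa>(1)])
    fix i j u
    assume ij: "i \<in> I" "j \<in> I" and u: "u \<in> U" and pos: "w i u > 0" "w j u > 0"
    \<comment> \<open>For \<open>\<omega> u \<ge> 0\<close>, the inequality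
      \<open>c v * \<omega> u < \<omega> v\<close> implies both winning conditions against
      \<open>v\<close>.\<close>
    define c where "c v = max (w i v / w i u) (w j v / w j u)" for v
    have c: "c v \<ge> 0" if "v \<in> U" for v
      using w[OF ij(1) that] pos by (auto simp: c_def le_max_iff_disj)
    \<comment> \<open>A maximum of nonnegative ratios is at most their sum. The leading
      \<open>1\<close> is enlarged to \<open>1 + 1\<close>, the summand at \<open>v = u\<close>,
      which completes both totals over \<open>U\<close>.\<close>
    have "1 + (\<Sum>v\<in>U - {u}. c v)
        \<le> (w i u / w i u + w j u / w j u) + (\<Sum>v\<in>U - {u}. w i v / w i u + w j v / w j u)"
      using pos w ij by (intro add_mono sum_mono) (auto simp: c_def)
    also have "\<dots> = (\<Sum>v\<in>U. w i v / w i u + w j v / w j u)"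
      using U u by (subst (2) sum.remove[of _ u]) auto
    also have "\<dots> = sum (w i) U / w i u + sum (w j) U / w j u"
      by (simp add: sum.distrib sum_divide_distrib)
    finally have le: "1 + (\<Sum>v\<in>U - {u}. c v) \<le> sum (w i) U / w i u + sum (w j) U / w j u" .
    have c': "(\<Sum>v\<in>U - {u}. c v) \<ge> 0"
      using c by (intro sum_nonneg) auto
    have "1 / (sum (w i) U / w i u + sum (w j) U / w j u) \<le> 1 / (1 + (\<Sum>v\<in>U - {u}. c v))"
      using le c' by (intro divide_left_mono mult_pos_pos) auto
    also have "\<dots> = measure M {\<omega> \<in> space M. \<forall>v\<in>U - {u}. c v * \<omega> u < \<omega> v}"
      using exponential_race[OF U(1) u, of c] c c' unfolding M_def by (simp add: measure_def)
    also have "\<dots> \<le> measure M {\<omega> \<in> space M. g \<omega> \<in> {h. h i = u \<and> h j = u}}"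
    \<comment> \<open>The inclusion uses \<open>\<omega> u \<ge> 0\<close>, which holds only almost
      everywhere because the clocks are defined over all reals.\<close>
    proof (rule M.finite_measure_mono_AE)
      have "{\<omega> \<in> space M. sel i \<omega> = u \<and> sel j \<omega> = u} \<in> sets M"
        by measurable
      then show "{\<omega> \<in> space M. g \<omega> \<in> {h. h i = u \<and> h j = u}} \<in> sets M"
        using ij by (simp add: g_def)
      have "AE y in density lborel (exponential_density 1). y \<ge> 0"
        by (subst AE_density) (auto simp: exponential_density_def)
      then have "AE \<omega> in M. \<omega> u \<ge> 0"
        unfolding M_def by (intro AE_PiM_component prob_space_exponential_density u) auto
      then show "AE \<omega> in M. \<omega> \<in> {\<omega> \<in> space M. \<forall>v\<in>U - {u}. c v * \<omega> u < \<omega> v}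
          \<longrightarrow> \<omega> \<in> {\<omega> \<in> space M. g \<omega> \<in> {h. h i = u \<and> h j = u}}"
      proof eventually_elim
        fix \<omega> :: "'u \<Rightarrow> real" assume \<omega>: "\<omega> u \<ge> 0"
        have "wins l u \<omega>" if l: "l = i \<or> l = j" and less: "\<And>v. v \<in> U - {u} \<Longrightarrow> c v * \<omega> u < \<omega> v" for l
          unfolding wins_def
        proof (intro conjI ballI u)
          fix v assume v: "v \<in> U - {u}"
          have "w l v / w l u * \<omega> u \<le> c v * \<omega> u"
            using l \<omega> by (intro mult_right_mono) (auto simp: c_def)
          with less[OF v] have "w l v / w l u * \<omega> u < \<omega> v" by simp
          then show "w l v * \<omega> u < w l u * \<omega> v"
            using l pos by (auto simp: field_simps)
        qed
        then show "\<omega> \<in> {\<omega> \<in> space M. \<forall>v\<in>U - {u}. c v * \<omega> u < \<omega> v}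
            \<longrightarrow> \<omega> \<in> {\<omega> \<in> space M. g \<omega> \<in> {h. h i = u \<and> h j = u}}"
          using ij sel_eq by (auto simp: g_def)
      qed
    qed
    finally show "measure_pmf.prob \<kappa> {g. g i = u \<and> g j = u}
        \<ge> 1 / (sum (w i) U / w i u + sum (w j) U / w j u)"
      unfolding \<kappa>(2) .
  qed
qed

section \<open>Sums over words of fixed length and the memoryless channel\<close>

lemma finite_lists_len [simp]: "finite (lists_len n :: 'a::finite list set)"
  using finite_lists_length_eq[of "UNIV :: 'a set" n] by (simp add: lists_len_def)

lemma lists_len_nonempty [simp]: "lists_len n \<noteq> {}"
  by (simp add: lists_len_def Ex_list_of_length)

text \<open>Distributivity, by splitting off the first letter; it yields the normalization of
  \<open>chan_n\<close>.\<close>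

lemma sum_prod_lists_len:
  fixes f :: "nat \<Rightarrow> 'a::finite \<Rightarrow> real"
  shows "(\<Sum>y\<in>lists_len n. \<Prod>i<n. f i (y ! i)) = (\<Prod>i<n. \<Sum>a\<in>UNIV. f i a)"
proof (induction n arbitrary: f)
  case 0
  have "lists_len 0 = {[] :: 'a list}" by (auto simp: lists_len_def)
  then show ?case by simp
next
  case (Suc n)
  have "lists_len (Suc n) = (\<lambda>(a, xs). a # xs) ` (UNIV \<times> (lists_len n :: 'a list set))"
    by (auto simp: lists_len_def length_Suc_conv image_iff)
  moreover have "inj_on (\<lambda>(a, xs). a # xs) (UNIV \<times> (lists_len n :: 'a list set))"
    by (auto simp: inj_on_def)
  ultimately have "(\<Sum>y\<in>lists_len (Suc n). \<Prod>i<Suc n. f i (y ! i))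
      = (\<Sum>(a, xs)\<in>UNIV \<times> lists_len n. \<Prod>i<Suc n. f i ((a # xs) ! i))"
    by (simp add: sum.reindex case_prod_unfold)
  also have "\<dots> = (\<Sum>a\<in>UNIV. f 0 a) * (\<Sum>xs\<in>lists_len n. \<Prod>i<n. f (Suc i) (xs ! i))"
    by (simp add: prod.lessThan_Suc_shift sum.cartesian_product[symmetric] sum_product del: prod.lessThan_Suc)
  also have "\<dots> = (\<Prod>i<Suc n. \<Sum>a\<in>UNIV. f i a)"
    by (simp add: Suc.IH[of "\<lambda>i. f (Suc i)"] prod.lessThan_Suc_shift del: prod.lessThan_Suc)
  finally show ?case .
qed

lemma sum_pmf_UNIV: "(\<Sum>a\<in>UNIV. pmf p a) = 1" for p :: "'a::finite pmf"
  by (rule sum_pmf_eq_1) auto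

lemma sum_chan_n: "(\<Sum>y\<in>lists_len n. chan_n W n x \<theta> y) = 1" for W :: "'x \<Rightarrow> 't \<Rightarrow> 'y::finite pmf"
  unfolding chan_n_def by (subst sum_prod_lists_len) (simp add: sum_pmf_UNIV)

lemma chan_n_nonneg: "chan_n W n x \<theta> y \<ge> 0"
  unfolding chan_n_def by (intro prod_nonneg) auto

lemma source_k_nonneg: "source_k PS k s \<ge> 0"
  unfolding source_k_def by (intro prod_nonneg) auto

lemma qchan_n_nonneg: "qchan_n W qT n x y \<ge> 0"
  unfolding qchan_n_def by (intro sum_nonneg mult_nonneg_nonneg prod_nonneg chan_n_nonneg) auto

section \<open>Scalar bounds on the mismatch probability\<close>

lemma mismatch_le_union_bound:
  fixes p a :: real
  assumes "0 \<le> p" "p \<le> 1" "a > 0"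
  shows "1 - p / (p + a) \<le> min 1 (real l * a) + (1 - p) ^ l"
proof (cases "real l * a \<ge> 1")
  case True
  have "0 \<le> p / (p + a)" "0 \<le> (1 - p) ^ l" using assms by auto
  with True show ?thesis by (simp add: min_def)
next
  case False
  have "1 - real l * p \<le> (1 - p) ^ l"
    using Bernoulli_inequality[of "- p" l] assms by simp
  \<comment> \<open>The right-hand side is \<open>(real l * a + (1 - p) ^ l) * (p + a) - a\<close>,
    grouped so that Bernoulli's inequality makes the first summand nonnegative.\<close>
  then have "0 \<le> a * (real l * p + (1 - p) ^ l - 1) + real l * a * a + p * (1 - p) ^ l"
    using assms by (intro add_nonneg_nonneg mult_nonneg_nonneg) auto
  then have "a \<le> (real l * a + (1 - p) ^ l) * (p + a)"
    by (simp add: algebra_simps)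
  then have "1 - p / (p + a) \<le> real l * a + (1 - p) ^ l"
    using assms by (simp add: field_simps)
  with False show ?thesis by (simp add: min_def)
qed

lemma powr_neg_pos_part_log:
  fixes r :: real
  assumes "r > 0" "l \<ge> 1"
  shows "2 powr (- max 0 (log 2 r - log 2 (real l))) = min 1 (real l / r)"
proof -
  have "- max 0 (log 2 r - log 2 (real l)) = min 0 (log 2 (real l / r))"
    using assms by (simp add: log_divide)
  also have "2 powr \<dots> = min 1 (real l / r)"
    using assms by (auto simp: min_def powr_log_cancel le_log_iff)
  finally show ?thesis .
qed

text \<open>Dividing numerator and denominator by \<open>v\<close> reduces this to
  \<open>mismatch_le_union_bound\<close> with \<open>a = vbar / v\<close>, the reciprocal of the
  likelihood ratio inside the information density.\<close>

lemma mismatch_le_info_bound: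
  fixes p v vbar :: real
  assumes "0 \<le> p" "p \<le> 1" "v \<ge> 0" "v > 0 \<Longrightarrow> vbar > 0" "l \<ge> 1"
  shows "1 - p * v / (p * v + vbar)
       \<le> 2 powr (- max 0 (log 2 (v / vbar) - log 2 (real l))) + (1 - p) ^ l"
proof (cases "v = 0")
  case True
  \<comment> \<open>Here the information density is \<open>log 2 0 = 0\<close>, so the exponential takes the right value \<open>1\<close>.\<close>
  then show ?thesis using assms by (simp add: log_def)
next
  case False
  with assms have v: "v > 0" "vbar > 0" by auto
  then have "p + vbar / v = (p * v + vbar) / v"
    by (simp add: add_divide_distrib)
  then have "p * v / (p * v + vbar) = p / (p + vbar / v)"
    by simp
  then show ?thesis
    using mismatch_le_union_bound[of p "vbar / v" l] powr_neg_pos_part_log[of "v / vbar" l] v assms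
    by simp
qed


section \<open>The random code obtained from the coupling\<close>

text \<open>Source words and channel outputs index the same coupling. If both select one pair from
  the ball of \<open>s\<close>, there is no excess distortion; summing the coupling bound over that
  ball produces the subtracted fraction.\<close>

lemma matching_code_exists:
  fixes W :: "'x::finite \<Rightarrow> 't::finite \<Rightarrow> 'y::finite pmf"
    and PS :: "'s::finite pmf" and dS :: "'s \<Rightarrow> 's \<Rightarrow> real" and dl :: real and k n :: nat
    and PX :: "'x list pmf" and PSh :: "'s list pmf" and qT :: "'t pmf"
  assumes PX: "set_pmf PX \<subseteq> lists_len n" and PSh: "set_pmf PSh \<subseteq> lists_len k"
  defines "p s \<equiv> measure_pmf.prob PSh (dball dS k dl s)"
    and "V \<equiv> qchan_n W qT n"
    and "Vbar y \<equiv> \<Sum>x\<in>lists_len n. pmf PX x * qchan_n W qT n x y"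
  obtains \<psi> where "is_rcode k n \<psi>"
    "\<And>\<theta>. measure_pmf.expectation \<psi> (\<lambda>(f, \<phi>). code_error W PS dS dl k n f \<phi> \<theta>)
       \<le> (\<Sum>s\<in>lists_len k. source_k PS k s * (\<Sum>x\<in>lists_len n. pmf PX x *
            (\<Sum>y\<in>lists_len n. chan_n W n x \<theta> y * (1 - p s * V x y / (p s * V x y + Vbar y)))))"
proof -
  let ?X = "lists_len n :: 'x list set" and ?S = "lists_len k :: 's list set"
    and ?Y = "lists_len n :: 'y list set"
  define U where "U = ?S \<times> ?X"
  define I where "I = ?S <+> ?Y"
  define B where "B s = dball dS k dl s" for s
  have B: "B s \<subseteq> ?S" for s by (auto simp: B_def dball_def)
  have finB: "finite (B s)" for s using B by (rule finite_subset) simp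
  have p: "p s = sum (pmf PSh) (B s)" for s
    unfolding p_def B_def[symmetric] by (rule measure_measure_pmf_finite[OF finB])
  have PX1: "sum (pmf PX) ?X = 1" and PSh1: "sum (pmf PSh) ?S = 1"
    using PX PSh by (auto intro!: sum_pmf_eq_1)
  have V0: "V x y \<ge> 0" for x y unfolding V_def by (rule qchan_n_nonneg)
  have Vb: "Vbar y = (\<Sum>x\<in>?X. pmf PX x * V x y)" for y unfolding Vbar_def V_def ..
  \<comment> \<open>The weights stay unnormalized: their totals are \<open>p s\<close> at
    \<open>Inl s\<close> and \<open>Vbar y\<close> at \<open>Inr y\<close>, and the coupling bound
    divides by them itself.\<close>
  define w :: "'s list + 'y list \<Rightarrow> 's list \<times> 'x list \<Rightarrow> real" where
    "w i u = pmf PSh (fst u) * pmf PX (snd u) *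
       (case i of Inl s \<Rightarrow> of_bool (fst u \<in> B s) | Inr y \<Rightarrow> V (snd u) y)" for i u
  have w_Inl: "sum (w (Inl s)) U = p s" for s
  proof -
    have "sum (w (Inl s)) U = (\<Sum>sh\<in>?S. pmf PSh sh * of_bool (sh \<in> B s)) * sum (pmf PX) ?X"
      unfolding U_def w_def sum_product
      by (subst sum.cartesian_product) (simp add: case_prod_unfold mult_ac)
    also have "\<dots> = (\<Sum>sh\<in>?S \<inter> B s. pmf PSh sh)"
      by (simp add: PX1 sum.inter_restrict of_bool_def if_distrib cong: if_cong)
    also have "?S \<inter> B s = B s" using B by auto
    finally show ?thesis by (simp add: p)
  qed
  have w_Inr: "sum (w (Inr y)) U = Vbar y" for y
  proof -
    have "sum (w (Inr y)) U = sum (pmf PSh) ?S * (\<Sum>x\<in>?X. pmf PX x * V x y)"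
      unfolding U_def w_def sum_product
      by (subst sum.cartesian_product) (simp add: case_prod_unfold mult_ac)
    then show ?thesis by (simp add: PSh1 Vb)
  qed
  have "finite U" "U \<noteq> {}" "finite I" by (auto simp: U_def I_def)
  moreover have "w i u \<ge> 0" for i u
    using V0 by (auto simp: w_def split: sum.split)
  ultimately obtain \<kappa> where \<kappa>: "set_pmf \<kappa> \<subseteq> PiE I (\<lambda>_. U)"
    and coupling: "\<And>i j u. \<lbrakk>i \<in> I; j \<in> I; u \<in> U; w i u > 0; w j u > 0\<rbrakk> \<Longrightarrow>
       measure_pmf.prob \<kappa> {g. g i = u \<and> g j = u} \<ge> 1 / (sum (w i) U / w i u + sum (w j) U / w j u)"
    by (rule exponential_race_coupling[of U I w]) blast+
  have fin: "finite (set_pmf \<kappa>)"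
    using \<open>finite U\<close> \<open>finite I\<close> by (intro finite_subset[OF \<kappa>] finite_PiE) auto
  note [simp] = integrable_measure_pmf_finite[OF fin]
  have match: "pmf PSh sh * pmf PX x * V x y / (p s * V x y + Vbar y)
      \<le> measure_pmf.prob \<kappa> {g. g (Inl s) = (sh, x) \<and> g (Inr y) = (sh, x)}"
    if s: "s \<in> ?S" and y: "y \<in> ?Y" and u: "sh \<in> B s" "x \<in> ?X" for s y sh x
  \<comment> \<open>\<open>coupling\<close> needs positive weights; where the product vanishes, the
    claimed lower bound is \<open>0\<close>.\<close>
  proof (cases "pmf PSh sh * pmf PX x * V x y = 0")
    case False
    then have pos: "pmf PSh sh > 0" "pmf PX x > 0" "V x y > 0"
      using V0[of x y] by (auto simp: less_le)
    have "1 / (p s / (pmf PSh sh * pmf PX x) + Vbar y / (pmf PSh sh * pmf PX x * V x y))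
        \<le> measure_pmf.prob \<kappa> {g. g (Inl s) = (sh, x) \<and> g (Inr y) = (sh, x)}"
      using coupling[of "Inl s" "Inr y" "(sh, x)"] s y u B[of s] pos
      by (auto simp: w_Inl w_Inr) (auto simp: w_def I_def U_def)
    also have "p s / (pmf PSh sh * pmf PX x) + Vbar y / (pmf PSh sh * pmf PX x * V x y)
        = (p s * V x y + Vbar y) / (pmf PSh sh * pmf PX x * V x y)"
      using pos by (simp add: add_divide_distrib)
    finally show ?thesis by simp
  qed auto
  \<comment> \<open>The encoder sends the input component of its pair and the decoder outputs the
    reproduction component of its own; both use the same \<open>g\<close>.\<close>
  define \<psi> where "\<psi> = map_pmf (\<lambda>g. (\<lambda>s. snd (g (Inl s)), \<lambda>y. fst (g (Inr y)))) \<kappa>"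
  have per_source: "measure_pmf.expectation \<kappa> (\<lambda>g. \<Sum>y\<in>?Y.
        of_bool (distortion dS k s (fst (g (Inr y))) > dl) * chan_n W n (snd (g (Inl s))) \<theta> y)
      \<le> (\<Sum>x\<in>?X. pmf PX x * (\<Sum>y\<in>?Y. chan_n W n x \<theta> y *
            (1 - p s * V x y / (p s * V x y + Vbar y))))"
    (is "measure_pmf.expectation \<kappa> ?err \<le> _") if s: "s \<in> ?S" for s \<theta>
  proof -
    let ?c = "\<lambda>x y. chan_n W n x \<theta> y"
    let ?m = "\<lambda>y u. {g :: 's list + 'y list \<Rightarrow> 's list \<times> 'x list. g (Inl s) = u \<and> g (Inr y) = u}"
    let ?T = "B s \<times> ?X"
    have "?err g \<le> 1 - (\<Sum>y\<in>?Y. \<Sum>u\<in>?T. ?c (snd u) y * indicator (?m y u) g)" for g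
    proof -
      \<comment> \<open>Excess distortion and a match inside \<open>?T\<close> exclude each other,
        so their indicators together contribute the channel probability at most once.\<close>
      have "of_bool (distortion dS k s (fst (g (Inr y))) > dl) * ?c (snd (g (Inl s))) y
          + (\<Sum>u\<in>?T. ?c (snd u) y * indicator (?m y u) g) \<le> ?c (snd (g (Inl s))) y"
        (is "?b * _ + ?sum \<le> _") for y
      proof -
        have "?sum = (\<Sum>u\<in>?T. if u = g (Inl s) then
            (if g (Inl s) = g (Inr y) then ?c (snd (g (Inl s))) y else 0) else 0)"
          by (intro sum.cong) (auto simp: indicator_def)
        \<comment> \<open>Only the pair selected by the encoder can contribute to the sum over
          \<open>?T\<close>.\<close>
        also have "\<dots> = (if g (Inl s) \<in> ?T \<and> g (Inl s) = g (Inr y) then ?c (snd (g (Inl s))) y else 0)"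
          using finB[of s] by (subst sum.delta) auto
        also have "\<dots> \<le> (1 - ?b) * ?c (snd (g (Inl s))) y"
          using chan_n_nonneg[of W n "snd (g (Inl s))" \<theta> y]
          by (auto simp: B_def dball_def mem_Times_iff)
        finally show ?thesis by (simp add: algebra_simps)
      qed
      then have "?err g + (\<Sum>y\<in>?Y. \<Sum>u\<in>?T. ?c (snd u) y * indicator (?m y u) g)
          \<le> (\<Sum>y\<in>?Y. ?c (snd (g (Inl s))) y)"
        unfolding sum.distrib[symmetric] by (intro sum_mono)
      then show ?thesis by (simp add: sum_chan_n)
    qed
    then have "measure_pmf.expectation \<kappa> ?err \<le> measure_pmf.expectation \<kappa>
        (\<lambda>g. 1 - (\<Sum>y\<in>?Y. \<Sum>u\<in>?T. ?c (snd u) y * indicator (?m y u) g))"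
      by (intro integral_mono) auto
    also have "\<dots> = 1 - (\<Sum>y\<in>?Y. \<Sum>u\<in>?T. ?c (snd u) y * measure_pmf.prob \<kappa> (?m y u))"
      by simp
    also have "\<dots> \<le> 1 - (\<Sum>y\<in>?Y. \<Sum>u\<in>?T. ?c (snd u) y *
        (pmf PSh (fst u) * pmf PX (snd u) * V (snd u) y / (p s * V (snd u) y + Vbar y)))"
      using match[OF s] by (intro diff_left_mono sum_mono mult_left_mono chan_n_nonneg) auto
    also have "(\<Sum>y\<in>?Y. \<Sum>u\<in>?T. ?c (snd u) y *
        (pmf PSh (fst u) * pmf PX (snd u) * V (snd u) y / (p s * V (snd u) y + Vbar y)))
      = (\<Sum>y\<in>?Y. \<Sum>x\<in>?X. pmf PX x * (?c x y * (p s * V x y / (p s * V x y + Vbar y))))"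
    proof (rule sum.cong[OF refl])
      fix y :: "'y list"
      \<comment> \<open>\<open>?h\<close> is independent of the reproduction, so the sum over
        \<open>B s\<close> contributes exactly the factor \<open>p s\<close>.\<close>
      let ?h = "\<lambda>x. pmf PX x * (?c x y * (V x y / (p s * V x y + Vbar y)))"
      have "(\<Sum>u\<in>?T. ?c (snd u) y *
        (pmf PSh (fst u) * pmf PX (snd u) * V (snd u) y / (p s * V (snd u) y + Vbar y)))
        = (\<Sum>(sh, x)\<in>?T. pmf PSh sh * ?h x)"
        by (simp add: case_prod_unfold mult_ac)
      also have "\<dots> = p s * (\<Sum>x\<in>?X. ?h x)"
        by (simp add: sum.cartesian_product[symmetric] sum_product p)
      finally show "(\<Sum>u\<in>?T. ?c (snd u) y *
        (pmf PSh (fst u) * pmf PX (snd u) * V (snd u) y / (p s * V (snd u) y + Vbar y)))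
        = (\<Sum>x\<in>?X. pmf PX x * (?c x y * (p s * V x y / (p s * V x y + Vbar y))))"
        by (simp add: sum_distrib_left mult_ac)
    qed
    \<comment> \<open>The constant \<open>1\<close> is rewritten as the total mass of input and
      output, to be merged with the subtracted sum.\<close>
    also have "1 - \<dots> = (\<Sum>x\<in>?X. pmf PX x * (\<Sum>y\<in>?Y. ?c x y))
        - (\<Sum>x\<in>?X. pmf PX x * (\<Sum>y\<in>?Y. ?c x y * (p s * V x y / (p s * V x y + Vbar y))))"
      by (subst sum.swap) (simp add: sum_chan_n PX1 sum_distrib_left)
    also have "\<dots> = (\<Sum>x\<in>?X. pmf PX x * (\<Sum>y\<in>?Y. ?c x y *
            (1 - p s * V x y / (p s * V x y + Vbar y))))"
      by (simp add: sum_subtractf right_diff_distrib)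
    finally show ?thesis .
  qed
  show thesis
  proof
    show "is_rcode k n \<psi>"
      using \<kappa> by (auto simp: is_rcode_def \<psi>_def I_def U_def PiE_iff mem_Times_iff subset_iff)
  next
    fix \<theta>
    have "measure_pmf.expectation \<psi> (\<lambda>(f, \<phi>). code_error W PS dS dl k n f \<phi> \<theta>)
      = measure_pmf.expectation \<kappa> (\<lambda>g. \<Sum>s\<in>?S. source_k PS k s * (\<Sum>y\<in>?Y.
          of_bool (distortion dS k s (fst (g (Inr y))) > dl) * chan_n W n (snd (g (Inl s))) \<theta> y))"
      unfolding \<psi>_def code_error_def
      by (simp add: sum_distrib_left of_bool_def mult_ac)
    also have "\<dots> = (\<Sum>s\<in>?S. source_k PS k s * measure_pmf.expectation \<kappa> (\<lambda>g. \<Sum>y\<in>?Y.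
          of_bool (distortion dS k s (fst (g (Inr y))) > dl) * chan_n W n (snd (g (Inl s))) \<theta> y))"
      by (subst Bochner_Integration.integral_sum) auto
    also have "\<dots> \<le> (\<Sum>s\<in>?S. source_k PS k s * (\<Sum>x\<in>?X. pmf PX x *
            (\<Sum>y\<in>?Y. chan_n W n x \<theta> y * (1 - p s * V x y / (p s * V x y + Vbar y)))))"
      using per_source by (intro sum_mono mult_left_mono source_k_nonneg)
    finally show "measure_pmf.expectation \<psi> (\<lambda>(f, \<phi>). code_error W PS dS dl k n f \<phi> \<theta>) \<le> \<dots>" .
  qed
qed


section \<open>Averaging over \<open>L\<close> and maximizing over state sequences\<close>

theorem theorem6:
  fixes W :: "'x::finite \<Rightarrow> 't::finite \<Rightarrow> 'y::finite pmf"
    and PS :: "'s::finite pmf"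
    and dS :: "'s \<Rightarrow> 's \<Rightarrow> real"
    and dl :: real
    and k n :: nat
    and PX :: "'x list pmf"
    and PSh :: "'s list pmf"
    and qT :: "'t pmf"
  assumes "set_pmf PX \<subseteq> lists_len n"
    and "set_pmf PSh \<subseteq> lists_len k"
    and "qT \<in> Pi_Theta W"
  shows "\<exists>\<psi>. is_rcode k n \<psi> \<and>
           (\<forall>PL :: 's list \<Rightarrow> nat pmf. (\<forall>s\<in>lists_len k. set_pmf (PL s) \<subseteq> {1..}) \<longrightarrow>
              rcode_error W PS dS dl k n \<psi>
                \<le> Max ((\<lambda>\<theta>. bound_term1 W qT PS k n PX PL \<theta> + bound_term2 PS dS dl k PSh PL)
                        ` lists_len n))"
proof -
  define p where "p s = measure_pmf.prob PSh (dball dS k dl s)" for s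
  define V where "V = qchan_n W qT n"
  define Vbar where "Vbar y = (\<Sum>x\<in>lists_len n. pmf PX x * V x y)" for y
  obtain \<psi> where code: "is_rcode k n \<psi>" and err:
    "\<And>\<theta>. measure_pmf.expectation \<psi> (\<lambda>(f, \<phi>). code_error W PS dS dl k n f \<phi> \<theta>)
       \<le> (\<Sum>s\<in>lists_len k. source_k PS k s * (\<Sum>x\<in>lists_len n. pmf PX x *
            (\<Sum>y\<in>lists_len n. chan_n W n x \<theta> y * (1 - p s * V x y / (p s * V x y + Vbar y)))))"
    unfolding p_def Vbar_def V_def using matching_code_exists[OF assms(1,2)] by blast
  have "rcode_error W PS dS dl k n \<psi>
      \<le> Max ((\<lambda>\<theta>. bound_term1 W qT PS k n PX PL \<theta> + bound_term2 PS dS dl k PSh PL) ` lists_len n)"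
    if PL: "\<forall>s\<in>lists_len k. set_pmf (PL s) \<subseteq> {1..}" for PL :: "'s list \<Rightarrow> nat pmf"
    unfolding rcode_error_def
  proof (intro Max.boundedI; clarsimp)
    fix \<theta> :: "'t list" assume \<theta>: "\<theta> \<in> lists_len n"
    define ex where "ex l x y = 2 powr (- max 0 (info_dens W qT n PX x y - log 2 (real l)))" for l x y
    have ex: "0 \<le> ex l x y" "ex l x y \<le> 1" for l x y
      using powr_mono[of "- max 0 (info_dens W qT n PX x y - log 2 (real l))" 0 2] by (auto simp: ex_def)
    define T1 where "T1 l = (\<Sum>x\<in>lists_len n. pmf PX x * (\<Sum>y\<in>lists_len n. chan_n W n x \<theta> y * ex l x y))" for l
    have PX1: "sum (pmf PX) (lists_len n) = 1"
      using assms(1) by (intro sum_pmf_eq_1) auto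
    have p01: "0 \<le> p s" "p s \<le> 1" for s
      by (auto simp: p_def)
    have T1: "0 \<le> T1 l" "T1 l \<le> 1" for l
    proof -
      show "0 \<le> T1 l"
        unfolding T1_def by (intro sum_nonneg mult_nonneg_nonneg chan_n_nonneg ex pmf_nonneg)
      have "T1 l \<le> (\<Sum>x\<in>lists_len n. pmf PX x * (\<Sum>y\<in>lists_len n. chan_n W n x \<theta> y * 1))"
        unfolding T1_def by (intro sum_mono mult_left_mono chan_n_nonneg ex pmf_nonneg)
      then show "T1 l \<le> 1" by (simp add: sum_chan_n PX1)
    qed
    have pointwise: "(\<Sum>x\<in>lists_len n. pmf PX x *
          (\<Sum>y\<in>lists_len n. chan_n W n x \<theta> y * (1 - p s * V x y / (p s * V x y + Vbar y))))
        \<le> T1 l + (1 - p s) ^ l" if "l \<ge> 1" for s l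
    proof -
      have "pmf PX x * (\<Sum>y\<in>lists_len n. chan_n W n x \<theta> y * (1 - p s * V x y / (p s * V x y + Vbar y)))
          \<le> pmf PX x * (\<Sum>y\<in>lists_len n. chan_n W n x \<theta> y * (ex l x y + (1 - p s) ^ l))"
        if x: "x \<in> lists_len n" for x
      \<comment> \<open>Outside the support of \<open>PX\<close>, \<open>Vbar y\<close> may vanish
        although \<open>V x y > 0\<close>; such \<open>x\<close> carry no mass. On the support,
        \<open>Vbar y\<close> dominates its own summand at \<open>x\<close>.\<close>
      proof (cases "pmf PX x = 0")
        case False
        have "1 - p s * V x y / (p s * V x y + Vbar y) \<le> ex l x y + (1 - p s) ^ l" for y
          unfolding ex_def info_dens_def V_def[symmetric] Vbar_def[symmetric]
        proof (rule mismatch_le_info_bound[OF p01 _ _ \<open>l \<ge> 1\<close>])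
          show "V x y \<ge> 0" by (simp add: V_def qchan_n_nonneg)
          assume "V x y > 0"
          with False have "0 < pmf PX x * V x y" by (simp add: less_le)
          also have "\<dots> \<le> Vbar y"
            unfolding Vbar_def by (rule member_le_sum) (auto simp: x V_def qchan_n_nonneg)
          finally show "Vbar y > 0" .
        qed
        then show ?thesis
          by (intro mult_left_mono sum_mono chan_n_nonneg pmf_nonneg)
      qed simp
      then have "(\<Sum>x\<in>lists_len n. pmf PX x *
          (\<Sum>y\<in>lists_len n. chan_n W n x \<theta> y * (1 - p s * V x y / (p s * V x y + Vbar y))))
        \<le> (\<Sum>x\<in>lists_len n. pmf PX x * (\<Sum>y\<in>lists_len n. chan_n W n x \<theta> y * (ex l x y + (1 - p s) ^ l)))"
        by (intro sum_mono)
      \<comment> \<open>\<open>(1 - p s) ^ l\<close> is constant in \<open>x\<close> and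
        \<open>y\<close>, hence unchanged by averaging over them.\<close>
      also have "\<dots> = T1 l + (1 - p s) ^ l"
        by (simp add: T1_def distrib_left sum.distrib sum_distrib_right[symmetric] sum_chan_n PX1)
      finally show ?thesis .
    qed
    have average: "(\<Sum>x\<in>lists_len n. pmf PX x *
          (\<Sum>y\<in>lists_len n. chan_n W n x \<theta> y * (1 - p s * V x y / (p s * V x y + Vbar y))))
        \<le> measure_pmf.expectation (PL s) T1 + measure_pmf.expectation (PL s) (\<lambda>l. (1 - p s) ^ l)"
      (is "?e \<le> _") if s: "s \<in> lists_len k" for s
    proof -
      \<comment> \<open>The support of \<open>PL s\<close> may be infinite; integrability comes from
        both functions taking values between \<open>0\<close> and \<open>1\<close>.\<close>
      have int: "integrable (PL s) T1" "integrable (PL s) (\<lambda>l. (1 - p s) ^ l)"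
        using T1 p01[of s]
        by (auto intro!: measure_pmf.integrable_const_bound[where B = 1] AE_I2 power_le_one)
      have "?e = measure_pmf.expectation (PL s) (\<lambda>l. ?e)" by simp
      also have "\<dots> \<le> measure_pmf.expectation (PL s) (\<lambda>l. T1 l + (1 - p s) ^ l)"
        \<comment> \<open>The pointwise bound requires \<open>l \<ge> 1\<close>, which is known only
          on the support of \<open>PL s\<close>.\<close>
        using PL s pointwise int by (intro integral_mono_AE) (auto simp: AE_measure_pmf_iff)
      also have "\<dots> = measure_pmf.expectation (PL s) T1 + measure_pmf.expectation (PL s) (\<lambda>l. (1 - p s) ^ l)"
        using int by simp
      finally show ?thesis .
    qed
    have "measure_pmf.expectation \<psi> (\<lambda>(f, \<phi>). code_error W PS dS dl k n f \<phi> \<theta>)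
        \<le> (\<Sum>s\<in>lists_len k. source_k PS k s *
            (measure_pmf.expectation (PL s) T1 + measure_pmf.expectation (PL s) (\<lambda>l. (1 - p s) ^ l)))"
      using average by (intro order_trans[OF err] sum_mono mult_left_mono source_k_nonneg)
    also have "\<dots> = bound_term1 W qT PS k n PX PL \<theta> + bound_term2 PS dS dl k PSh PL"
      unfolding bound_term1_def bound_term2_def T1_def ex_def p_def
      by (simp add: distrib_left sum.distrib)
    also have "\<dots> \<le> Max ((\<lambda>\<theta>. bound_term1 W qT PS k n PX PL \<theta> + bound_term2 PS dS dl k PSh PL) ` lists_len n)"
      using \<theta> by (intro Max_ge) auto
    finally show "measure_pmf.expectation \<psi> (\<lambda>(f, \<phi>). code_error W PS dS dl k n f \<phi> \<theta>) \<le> \<dots>" .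
  qed
  with code show ?thesis by blast
qed

end
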